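(* The candidate surface branched covers inducing candidate covers $\widetilde X\dashrightarrow X$ between triangular hyperbolic 2-orbifolds (i.e. with both $\widetilde X$ and $X$ triangular and hyperbolic) are precisely the following, all with $\widetilde\Sigma=\Sigma=S$: \begin{enumerate} \item $d=6$: $(5,1),(4,1,1),(2^3)$; \item $d=8$: $(5,1,1,1),(4,4),(2^4)$; \item $d=8$: $(7,1),(3,3,1,1),(2^4)$; \item $d=9$: $(7,1,1),(3,3,3),(2^4,1)$; \item $d=10$: $(8,1,1),(3,3,3,1),(2^5)$; \item $d=12$: $(8,2,1,1),(3^4),(2^6)$; \item $d=12$: $(9,1,1,1),(3^4),(2^6)$; \item $d=16$: $(7,7,1,1),(3^5,1),(2^8)$; \item $d=24$: $(7,7,7,1,1,1),(3^8),(2^{12})$. \end{enumerate}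
   Context: $S$ is the 2-sphere. A partition of $d$ is a finite unordered list (multiset) of positive integers with sum $d$; $\ell(\Pi)$ is the number of entries of $\Pi$; $(a^m,b,\ldots)$ means that $a$ is repeated $m$ times. A candidate surface branched cover consists of closed connected orientable surfaces $\widetilde\Sigma,\Sigma$ (up to homeomorphism), integers $d\geq 2$ and $n\geq 1$, and an unordered collection (repetitions allowed) $\Pi_1,\ldots,\Pi_n$ of partitions of $d$, each with at least one entry $>1$, satisfying the Riemann-Hurwitz condition $\chi(\widetilde\Sigma)-\sum_i\ell(\Pi_i)=d\,(\chi(\Sigma)-n)$. A 2-orbifold $X=\Sigma(p_1,\ldots,p_n)$ is a closed connected orientable surface $\Sigma$ with $n$ cone points of orders $p_i\geq 2$; $\chi^{\mathrm{orb}}(X)=\chi(\Sigma)-\sum_i(1-1/p_i)$, and $X$ is hyperbolic if $\chi^{\mathrm{orb}}(X)<0$. $X$ is triangular if it has the form $S(p,q,r)$ with $p,q,r\geq 2$. With $\Pi_i=(d_{ij})_j$, set $p_i=\mathrm{lcm}_j\, d_{ij}$ and $p_{ij}=p_i/d_{ij}$. The induced candidate 2-orbifold cover is $\widetilde X\dashrightarrow X$ with $X=\Sigma(p_1,\ldots,p_n)$ and $\widetilde X=\widetilde\Sigma((p_{ij})_{i,j})$, where orders equal to $1$ are dropped. *)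

theory Defs
  imports Complex_Main "HOL-Library.Multiset"
begin

definition is_partition :: "nat \<Rightarrow> nat multiset \<Rightarrow> bool" where
  "is_partition d P \<longleftrightarrow> (\<forall>k\<in>#P. k \<ge> 1) \<and> sum_mset P = d"

text \<open>
  By the classification of surfaces, a closed connected orientable surface up to homeomorphism
  is represented by its genus; the 2-sphere is genus 0.
\<close>

definition euler_char :: "nat \<Rightarrow> int" where
  "euler_char g = 2 - 2 * int g"

text \<open>
  The collection \<open>\<Pi>\<^sub>1, \<dots>, \<Pi>\<^sub>n\<close> is unordered with repetitions, hence a multiset of multisets;
  the number \<open>n\<close> of branch points is its size.
\<close>

record surface_cover_data =
  cover_genus :: nat
  base_genus :: nat
  degree :: nat
  partitions :: "nat multiset multiset"

definition candidate_surface_cover :: "surface_cover_data \<Rightarrow> bool" where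
  "candidate_surface_cover C \<longleftrightarrow>
     degree C \<ge> 2 \<and>
     size (partitions C) \<ge> 1 \<and>
     (\<forall>P\<in>#partitions C. is_partition (degree C) P \<and> (\<exists>k\<in>#P. k > 1)) \<and>
     euler_char (cover_genus C) - (\<Sum>P\<in>#partitions C. int (size P)) =
       int (degree C) * (euler_char (base_genus C) - int (size (partitions C)))"

record orbifold =
  genus :: nat
  cone_orders :: "nat multiset"

definition orbifold_euler_char :: "orbifold \<Rightarrow> real" where
  "orbifold_euler_char X =
     real_of_int (euler_char (genus X)) - (\<Sum>p\<in>#cone_orders X. 1 - 1 / real p)"

definition hyperbolic :: "orbifold \<Rightarrow> bool" where
  "hyperbolic X \<longleftrightarrow> orbifold_euler_char X < 0"

definition triangular :: "orbifold \<Rightarrow> bool" where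
  "triangular X \<longleftrightarrow>
     (\<exists>p q r. p \<ge> 2 \<and> q \<ge> 2 \<and> r \<ge> 2 \<and> X = \<lparr>genus = 0, cone_orders = {#p, q, r#}\<rparr>)"

definition partition_lcm :: "nat multiset \<Rightarrow> nat" where
  "partition_lcm P = Lcm (set_mset P)"

definition induced_base :: "surface_cover_data \<Rightarrow> orbifold" where
  "induced_base C =
     \<lparr>genus = base_genus C, cone_orders = image_mset partition_lcm (partitions C)\<rparr>"

text \<open>
  Each entry of each partition contributes, with multiplicity, the order \<open>p\<^sub>i\<^sub>j = p\<^sub>i div d\<^sub>i\<^sub>j\<close>
  (the division is exact); orders equal to 1 are not cone points.
\<close>

definition induced_cover :: "surface_cover_data \<Rightarrow> orbifold" where
  "induced_cover C =
     \<lparr>genus = cover_genus C,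
      cone_orders = filter_mset (\<lambda>p. p \<noteq> 1)
        (\<Sum>P\<in>#partitions C. image_mset (\<lambda>k. partition_lcm P div k) P)\<rparr>"

definition sphere_cover :: "nat \<Rightarrow> nat multiset multiset \<Rightarrow> surface_cover_data" where
  "sphere_cover d Ps = \<lparr>cover_genus = 0, base_genus = 0, degree = d, partitions = Ps\<rparr>"

end

theory Submission
  imports Defs
begin

text \<open>
  Multiplicativity of the orbifold Euler characteristic makes the search finite. An entry equal
  to the lcm \<open>p\<close> of its partition gives no cone point upstairs, so if both orbifolds
  are triangular, the three partitions have exactly three exceptional entries in total, all of
  them proper divisors of the respective lcm. Riemann-Hurwitz then says that the numbers of the
  remaining entries add up to \<open>d - 1\<close>. An lcm argument shows that each partition attains its lcm, so
  \<open>p \<le> d\<close>; weighing the equations \<open>d = m p + e\<close> against \<open>m\<^sub>1 + m\<^sub>2 + m\<^sub>3 = d - 1\<close> leaves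
  the base orders \<open>(2,3,7)\<close>, \<open>(2,3,8)\<close>, \<open>(2,3,9)\<close> and \<open>(2,4,5)\<close>, where the same
  relation determines \<open>d\<close> from the exceptional entries.
\<close>

section \<open>Exceptional entries of a partition\<close>

definition exceptional :: "nat multiset \<Rightarrow> nat multiset" where
  "exceptional P = filter_mset (\<lambda>k. k \<noteq> partition_lcm P) P"

text \<open>The value 0 is possible, as for the partition \<open>{#2, 3#}\<close>: its lcm is no
  entry, and all its entries are exceptional.\<close>

definition full_count :: "nat multiset \<Rightarrow> nat" where
  "full_count P = count P (partition_lcm P)"

lemma partition_decomp:
  "P = replicate_mset (full_count P) (partition_lcm P) + exceptional P"
  by (rule multiset_eqI) (auto simp: exceptional_def full_count_def)

lemma size_decomp: "size P = full_count P + size (exceptional P)"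
  using arg_cong[where f = size, OF partition_decomp[of P]] by simp

lemma sum_decomp: "sum_mset P = full_count P * partition_lcm P + sum_mset (exceptional P)"
  using arg_cong[where f = sum_mset, OF partition_decomp[of P]] by simp

lemma partition_lcm_pos:
  assumes "is_partition d P"
  shows "partition_lcm P > 0"
  using assms unfolding partition_lcm_def is_partition_def
  by (metis Lcm_0_iff finite_set_mset gr0I not_one_le_zero)

lemma partition_lcm_eqI:
  assumes "p \<in># P" "\<And>k. k \<in># P \<Longrightarrow> k dvd p"
  shows "partition_lcm P = p"
  unfolding partition_lcm_def
  using assms by (intro dvd_antisym) (auto intro: Lcm_least)

lemma exceptional_dvd:
  assumes "is_partition d P" "k \<in># exceptional P"
  shows "k dvd partition_lcm P" "k < partition_lcm P" "k \<ge> 1"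
proof -
  show d: "k dvd partition_lcm P"
    using assms by (auto simp: exceptional_def partition_lcm_def)
  have "k \<noteq> partition_lcm P" "partition_lcm P > 0"
    using assms partition_lcm_pos by (auto simp: exceptional_def)
  then show "k < partition_lcm P"
    using d by (simp add: dvd_imp_le order.not_eq_order_implies_strict)
  show "k \<ge> 1" using assms by (auto simp: exceptional_def is_partition_def)
qed

lemma proper_divisor_le_half:
  fixes k p :: nat
  assumes "k dvd p" "k < p"
  shows "2 * k \<le> p"
proof -
  obtain c where c: "p = k * c" using assms by auto
  then have "c \<noteq> 0" "c \<noteq> 1" using assms(2) by auto
  then have "2 \<le> c" by linarith
  then show ?thesis using c mult_le_mono2[of 2 c k] by linarith
qed

lemma size_le_sum_mset:
  fixes E :: "nat multiset"
  shows "(\<And>k. k \<in># E \<Longrightarrow> 1 \<le> k) \<Longrightarrow> size E \<le> sum_mset E"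
proof (induction E)
  case (add x E)
  have "1 \<le> x" "size E \<le> sum_mset E" using add by auto
  then show ?case by simp
qed simp

lemma size_exceptional_le_sum:
  "is_partition d P \<Longrightarrow> size (exceptional P) \<le> sum_mset (exceptional P)"
  by (intro size_le_sum_mset exceptional_dvd(3))

text \<open>Every entry \<open>k\<close> is positive and divides the lcm, so the quotient is 1 only
  for \<open>k\<close> equal to the lcm. This turns the number of cone points upstairs into a number
  of exceptional entries.\<close>

lemma size_cone_orders:
  assumes "is_partition d P"
  shows "size (filter_mset (\<lambda>p. p \<noteq> 1) (image_mset (\<lambda>k. partition_lcm P div k) P))
           = size (exceptional P)"
proof -
  have "filter_mset (\<lambda>k. partition_lcm P div k \<noteq> 1) P = exceptional P"
    unfolding exceptional_def
  proof (rule filter_mset_cong[OF refl])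
    fix k assume k: "k \<in># P"
    then have "k > 0" "k dvd partition_lcm P"
      using assms by (auto simp: is_partition_def partition_lcm_def)
    then show "partition_lcm P div k \<noteq> 1 \<longleftrightarrow> k \<noteq> partition_lcm P"
      by (auto)
  qed
  then show ?thesis by (simp add: filter_mset_image_mset)
qed

text \<open>Turns a bound on the support into an explicit multiset in which only the multiplicities
  are unknown.\<close>

lemma mset_eq_sum_count:
  assumes "finite A" "set_mset E \<subseteq> A"
  shows "E = (\<Sum>k\<in>A. replicate_mset (count E k) k)"
proof (rule multiset_eqI)
  fix x
  have "count (\<Sum>k\<in>A. replicate_mset (count E k) k) x = (\<Sum>k\<in>A. if x = k then count E k else 0)"
    by (simp add: count_sum eq_commute)
  also have "\<dots> = count E x"
    using assms by (auto simp: not_in_iff[symmetric])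
  finally show "count E x = count (\<Sum>k\<in>A. replicate_mset (count E k) k) x" by simp
qed

section \<open>Reduction to three partitions ordered by their lcm\<close>

lemma size_3_sorted:
  fixes f :: "'a \<Rightarrow> 'b :: linorder"
  assumes "size M = 3"
  obtains x y z where "M = {#x, y, z#}" "f x \<le> f y" "f y \<le> f z"
proof -
  obtain xs where xs: "mset xs = M" by (metis ex_mset)
  define ys where "ys = sort_key f xs"
  have ys: "mset ys = M" "sorted (map f ys)" using xs by (simp_all add: ys_def)
  then have "length ys = 3" using assms by (metis size_mset)
  then obtain x y z where "ys = [x, y, z]"
    by (auto simp: numeral_3_eq_3 length_Suc_conv)
  with ys that show thesis by auto
qed

text \<open>
  The last conjunct is hyperbolicity of the base with denominators cleared; hyperbolicity of the
  cover then follows, its orbifold Euler characteristic being \<open>d\<close> times that of the base.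
\<close>

definition cover_triple :: "nat \<Rightarrow> nat multiset \<Rightarrow> nat multiset \<Rightarrow> nat multiset \<Rightarrow> bool" where
  "cover_triple d P Q R \<longleftrightarrow>
     is_partition d P \<and> is_partition d Q \<and> is_partition d R \<and>
     partition_lcm P \<ge> 2 \<and> partition_lcm Q \<ge> 2 \<and> partition_lcm R \<ge> 2 \<and>
     size (exceptional P) + size (exceptional Q) + size (exceptional R) = 3 \<and>
     full_count P + full_count Q + full_count R + 1 = d \<and>
     partition_lcm Q * partition_lcm R + partition_lcm P * partition_lcm R
       + partition_lcm P * partition_lcm Q
       < partition_lcm P * partition_lcm Q * partition_lcm R"

text \<open>\<open>cover_triple\<close> does not order the lcms, so a fact proved for the third
  partition carries over to the other two.\<close>

lemma cover_triple_rotate: "cover_triple d P Q R \<Longrightarrow> cover_triple d Q R P"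
  by (simp only: cover_triple_def ac_simps)

lemma cover_triple_obtain:
  assumes C: "candidate_surface_cover C" "triangular (induced_cover C)"
    "triangular (induced_base C)" "hyperbolic (induced_base C)"
  obtains P Q R where "C = sphere_cover (degree C) {#P, Q, R#}"
    "cover_triple (degree C) P Q R"
    "partition_lcm P \<le> partition_lcm Q" "partition_lcm Q \<le> partition_lcm R"
proof -
  have "size (cone_orders (induced_base C)) = 3"
    using C(3) by (auto simp: triangular_def)
  then have "size (partitions C) = 3" by (simp add: induced_base_def)
  then obtain P Q R where ps: "partitions C = {#P, Q, R#}"
    and le: "partition_lcm P \<le> partition_lcm Q" "partition_lcm Q \<le> partition_lcm R"
    by (rule size_3_sorted)
  have part: "is_partition (degree C) P" "is_partition (degree C) Q" "is_partition (degree C) R"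
    using C(1) by (auto simp: candidate_surface_cover_def ps)
  have genus: "cover_genus C = 0" "base_genus C = 0"
    using C(2,3) by (auto simp: triangular_def induced_base_def induced_cover_def)
  have "\<forall>p\<in>#cone_orders (induced_base C). p \<ge> 2"
    using C(3) by (auto simp: triangular_def)
  then have ge2: "partition_lcm P \<ge> 2" "partition_lcm Q \<ge> 2" "partition_lcm R \<ge> 2"
    by (auto simp: induced_base_def ps)
  have "size (cone_orders (induced_cover C)) = 3"
    using C(2) by (auto simp: triangular_def)
  then have exc: "size (exceptional P) + size (exceptional Q) + size (exceptional R) = 3"
    using part[THEN size_cone_orders] by (simp add: induced_cover_def ps)
  \<comment> \<open>Riemann-Hurwitz with both genera 0 and three branch points: the lengths add up
    to \<open>d + 2\<close>. Removing the three exceptional entries leaves \<open>d - 1\<close> full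
    ones.\<close>
  have "2 - (int (size P) + int (size Q) + int (size R)) = - int (degree C)"
    using C(1) by (simp add: candidate_surface_cover_def euler_char_def genus ps algebra_simps)
  then have full: "full_count P + full_count Q + full_count R + 1 = degree C"
    using exc size_decomp[of P] size_decomp[of Q] size_decomp[of R] by linarith
  have "1 / real (partition_lcm P) + 1 / real (partition_lcm Q) + 1 / real (partition_lcm R) < 1"
    using C(4)
    by (simp add: hyperbolic_def orbifold_euler_char_def euler_char_def induced_base_def genus ps)
  then have "real (partition_lcm Q) * real (partition_lcm R)
      + real (partition_lcm P) * real (partition_lcm R)
      + real (partition_lcm P) * real (partition_lcm Q)
      < real (partition_lcm P) * real (partition_lcm Q) * real (partition_lcm R)"
    using ge2 by (simp add: field_simps)
  then have hyp: "partition_lcm Q * partition_lcm R + partition_lcm P * partition_lcm R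
       + partition_lcm P * partition_lcm Q
       < partition_lcm P * partition_lcm Q * partition_lcm R"
    by (simp only: of_nat_mult[symmetric] of_nat_add[symmetric] of_nat_less_iff)
  have "C = sphere_cover (degree C) {#P, Q, R#}"
    using genus ps by (simp add: sphere_cover_def)
  moreover have "cover_triple (degree C) P Q R"
    using part ge2 exc full hyp by (simp add: cover_triple_def)
  ultimately show thesis using le by (rule that)
qed

section \<open>Small degrees forced by a partition that misses its lcm\<close>

text \<open>Meant for a third partition with two entries, both exceptional: one of the other two
  partitions then has one exceptional entry \<open>z\<close>, the other none. Already
  \<open>m + n\<close> must reach \<open>d - 1\<close>, which orders of at least 2 allow only in
  small degree.\<close>

lemma degree_le_4_if_one_exceptional:
  fixes d :: nat
  assumes d: "m * p = d" "n * q + z = d" and z: "1 \<le> z" "2 * z \<le> q"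
    and pq: "p \<ge> 2" "q \<ge> 2" and mn: "m + n + 1 = d"
  shows "d \<le> 4"
proof -
  \<comment> \<open>Replacing an order by a smaller constant makes the equations linear inequalities
    in the counts.\<close>
  have *: "m * k \<le> d" if "k \<le> p" for k
    using mult_le_mono2[OF that, of m] d(1) by linarith
  have **: "n * k + z \<le> d" if "k \<le> q" for k
    using mult_le_mono2[OF that, of n] d(2) by linarith
  consider "p = 2" "q = 2" | "p = 2" "q = 3" | "p = 2" "q \<ge> 4" | "p \<ge> 3" "q = 2" | "p \<ge> 3" "q \<ge> 3"
    using pq by linarith
  then show ?thesis
  proof cases
    case 1
    \<comment> \<open>The sum of these equations together with \<open>m + n + 1 = d\<close> gives
      \<open>z = 2\<close>, against \<open>2 * z \<le> q\<close>.\<close>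
    then have "m * 2 = d" "n * 2 + z = d" using d by simp_all
    then show ?thesis using \<open>q = 2\<close> z mn by linarith
  next
    case 2
    then show ?thesis using z(1) mn *[of 2] **[of 3] by linarith
  next
    case 3
    then show ?thesis using z(1) mn *[of 2] **[of 4] by linarith
  next
    case 4
    then show ?thesis using z mn *[of 3] **[of 2] by linarith
  next
    case 5
    then show ?thesis using z(1) mn *[of 3] **[of 3] by linarith
  qed
qed

text \<open>Here the third partition holds all three exceptional entries, and
  \<open>d (1 - 1/p - 1/q) = 1\<close>. Degree 6 is singled out because the partition
  \<open>{#1, 2, 3#}\<close> does miss its lcm.\<close>

lemma degree_le_6_if_no_exceptional:
  fixes d :: nat
  assumes d: "m * p = d" "n * q = d" and pq: "p \<ge> 2" "q \<ge> 2" and mn: "m + n + 1 = d"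
  shows "d \<le> 6 \<and> (d = 6 \<longrightarrow> p = 2 \<and> q = 3 \<or> p = 3 \<and> q = 2)"
proof -
  have *: "m * k \<le> d" if "k \<le> p" for k
    using mult_le_mono2[OF that, of m] d(1) by linarith
  have **: "n * k \<le> d" if "k \<le> q" for k
    using mult_le_mono2[OF that, of n] d(2) by linarith
  consider "p = 2" "q = 2" | "p = 2 \<and> q = 3 \<or> p = 3 \<and> q = 2" | "p = 2" "q \<ge> 4"
    | "p \<ge> 4" "q = 2" | "p \<ge> 3" "q \<ge> 3"
    using pq by linarith
  then show ?thesis
  proof cases
    case 1
    then show ?thesis using d mn by simp
  next
    case 2
    moreover from this have "d = 6" using d mn by (elim disjE conjE) simp_all
    ultimately show ?thesis by simp
  next
    case 3
    then have "d \<le> 4" using mn *[of 2] **[of 4] by linarith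
    then show ?thesis by simp
  next
    case 4
    then have "d \<le> 4" using mn *[of 4] **[of 2] by linarith
    then show ?thesis by simp
  next
    case 5
    then have "d \<le> 3" using mn *[of 3] **[of 3] by linarith
    then show ?thesis by simp
  qed
qed

lemma three_parts_without_multiple:
  fixes x y z :: nat
  assumes "1 \<le> x" "1 \<le> y" "1 \<le> z" "x + y + z \<le> 6"
    "\<not> (y dvd x \<and> z dvd x)" "\<not> (x dvd y \<and> z dvd y)" "\<not> (x dvd z \<and> y dvd z)"
  shows "x + y + z = 6 \<and> {x, y, z} = {1, 2, 3}"
proof -
  \<comment> \<open>Each part is at most 4, since the other two are at least 1.\<close>
  have "x = 1 \<or> x = 2 \<or> x = 3 \<or> x = 4" "y = 1 \<or> y = 2 \<or> y = 3 \<or> y = 4"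
    "z = 1 \<or> z = 2 \<or> z = 3 \<or> z = 4"
    using assms(1-4) by linarith+
  then show ?thesis
    using assms(4-7) by (elim disjE; simp; blast?)
qed

text \<open>The smallest such pair is 2 and 3, with sum 5.\<close>

lemma two_parts_without_multiple:
  fixes x y :: nat
  assumes "1 \<le> x" "1 \<le> y" "x + y \<le> 4" "\<not> y dvd x" "\<not> x dvd y"
  shows False
proof -
  have "x = 1 \<or> x = 2 \<or> x = 3" "y = 1 \<or> y = 2 \<or> y = 3" using assms(1-3) by linarith+
  then show False using assms(3-5) by (elim disjE; simp)
qed

section \<open>The possible base orders\<close>

text \<open>Eliminating the counts gives
  \<open>d (1 - 1/p - 1/q - 1/r) + e1/p + e2/q + e3/r = 1\<close>. The first term is positive by
  hyperbolicity and \<open>d \<ge> r + e3\<close>, so large orders make the left side exceed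
  1.\<close>

lemma orders_cases:
  fixes d :: nat
  assumes m: "m1 \<ge> 1" "m2 \<ge> 1" "m3 \<ge> 1" "m1 + m2 + m3 + 1 = d"
    and d: "m1 * p + e1 = d" "m2 * q + e2 = d" "m3 * r + e3 = d"
    and e: "e1 + e2 + e3 \<ge> 3"
    and le: "2 \<le> p" "p \<le> q" "q \<le> r"
    and hyp: "q * r + p * r + p * q < p * q * r"
  shows "p = 2 \<and> (q = 3 \<and> r \<in> {7, 8, 9} \<or> q = 4 \<and> r = 5)"
proof -
  have *: "m1 * k + e1 \<le> d" if "k \<le> p" for k
    using mult_le_mono2[OF that, of m1] d(1) by linarith
  have **: "m2 * k + e2 \<le> d" if "k \<le> q" for k
    using mult_le_mono2[OF that, of m2] d(2) by linarith
  have ***: "m3 * k + e3 \<le> d" if "k \<le> r" for k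
    using mult_le_mono2[OF that, of m3] d(3) by linarith
  have r: "r + e3 \<le> d"
    using mult_le_mono1[OF m(3), of r] d(3) by linarith
  show ?thesis
  proof (cases "p = 2")
    case False
    have "r \<noteq> 3"
    proof
      assume "r = 3"
      then have "q = 3" "p = 3" using False le by linarith+
      with hyp \<open>r = 3\<close> show False by simp
    qed
    \<comment> \<open>Comparison with the orders (3,3,4), with weights 4, 4, 3, gives
      \<open>d + 4 e1 + 4 e2 + 3 e3 \<le> 12\<close>, against \<open>d \<ge> 4 + e3\<close>.\<close>
    then show ?thesis
      using False le m(4) e r *[of 3] **[of 3] ***[of 4] by linarith
  next
    case p: True
    have q: "q \<noteq> 2" using hyp p by auto
    consider "q = 3" | "q = 4" | "q \<ge> 5" using le p q by linarith
    then show ?thesis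
    proof cases
      case 1
      then have "r \<ge> 7" using hyp p by simp
      moreover have "\<not> r \<ge> 10"
      proof
        assume "r \<ge> 10"
        \<comment> \<open>Comparison with (2,3,10): the three bounds are weighted by 15, 10 and 3,
          the cofactors in 30. As \<open>d \<ge> 10 + e3\<close>, this forces \<open>d = 10\<close>
          and \<open>e3 = 0\<close>, and then \<open>e1 + e2 \<ge> 3\<close> is too much.\<close>
        then have "2 * d + 15 * e1 + 10 * e2 + 3 * e3 \<le> 30"
          using p 1 m(4) *[of 2] **[of 3] ***[of 10] by linarith
        moreover have "d = 10" using \<open>r \<ge> 10\<close> calculation r e by linarith
        ultimately show False using r e \<open>r \<ge> 10\<close> by linarith
      qed
      ultimately show ?thesis using p 1 by auto
    next
      case 2
      then have "r \<ge> 5" using hyp p by simp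
      moreover have "\<not> r \<ge> 6"
      proof
        assume "r \<ge> 6"
        \<comment> \<open>Comparison with (2,4,6), weights 6, 3 and 2; with
          \<open>d \<ge> 6 + e3\<close> it gives \<open>e1 + e2 + e3 \<le> 2\<close>.\<close>
        then have "d + 6 * e1 + 3 * e2 + 2 * e3 \<le> 12"
          using p 2 m(4) *[of 2] **[of 4] ***[of 6] by linarith
        then show False using r e \<open>r \<ge> 6\<close> by linarith
      qed
      ultimately show ?thesis using p 2 by auto
    next
      case 3
      \<comment> \<open>Comparison with (2,5,5), weights 5, 2, 2:
        \<open>d + 5 e1 + 2 e2 + 2 e3 \<le> 10\<close>, against
        \<open>d \<ge> 5 + e3\<close>.\<close>
      then show ?thesis
        using p le m(4) e r *[of 2] **[of 5] ***[of 5] by linarith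
    qed
  qed
qed

section \<open>Every partition attains its lcm\<close>

lemma partition_sum:
  "is_partition d P \<Longrightarrow> full_count P * partition_lcm P + sum_mset (exceptional P) = d"
  by (simp add: is_partition_def sum_decomp[symmetric])

lemma exceptional_singleton:
  assumes "is_partition d P" "exceptional P = {#z#}"
  shows "1 \<le> z" "2 * z \<le> partition_lcm P"
  using exceptional_dvd[OF assms(1), of z] proper_divisor_le_half[of z] assms(2) by auto

text \<open>If \<open>R\<close> missed its lcm, it would have at most three entries, none a multiple
  of all the others, while \<open>P\<close> and \<open>Q\<close> alone would supply the
  \<open>d - 1\<close> full entries. This forces a degree too small for such an \<open>R\<close>,
  except for \<open>{#1, 2, 3#}\<close>, where the base is not hyperbolic.\<close>

lemma full_count_nonzero:
  assumes t: "cover_triple d P Q R"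
  shows "full_count R \<noteq> 0"
proof
  assume zero: "full_count R = 0"
  have R: "exceptional R = R"
    using partition_decomp[of R] zero by simp
  have part: "is_partition d P" "is_partition d Q" "is_partition d R"
    and ge2: "partition_lcm P \<ge> 2" "partition_lcm Q \<ge> 2"
    and sz: "size (exceptional P) + size (exceptional Q) + size R = 3"
    and full: "full_count P + full_count Q + 1 = d"
    and hyp: "partition_lcm Q * partition_lcm R + partition_lcm P * partition_lcm R
       + partition_lcm P * partition_lcm Q
       < partition_lcm P * partition_lcm Q * partition_lcm R"
    using t zero R by (simp_all add: cover_triple_def)
  have sumP: "full_count P * partition_lcm P + sum_mset (exceptional P) = d"
    and sumQ: "full_count Q * partition_lcm Q + sum_mset (exceptional Q) = d"
    and sumR: "sum_mset R = d"
    using part[THEN partition_sum] R zero by simp_all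
  have pos: "1 \<le> k" if "k \<in># R" for k
    using part(3) that by (auto simp: is_partition_def)
  \<comment> \<open>An entry divisible by all entries would be the lcm, but exceptional entries are
    smaller.\<close>
  have ndvd: "\<not> (\<forall>k\<in>#R. k dvd x)" if "x \<in># R" for x
    using that R exceptional_dvd(2)[OF part(3), of x] partition_lcm_eqI[of x R] by auto
  consider "size R = 0" | "size R = 1" | "size R = 2" | "size R = 3" using sz by linarith
  then show False
  proof cases
    case 1
    then show False using sumR full by simp
  next
    case 2
    then obtain x where "R = {#x#}" using size_1_singleton_mset by blast
    then show False using ndvd[of x] by simp
  next
    case 3
    then obtain x y where xy: "R = {#x, y#}"
      by (metis size_1_singleton_mset size_eq_Suc_imp_eq_union numeral_2_eq_2 One_nat_def
          size_add_mset nat.inject)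
    have "d \<le> 4"
    proof (cases "size (exceptional P) = 0")
      case True
      then have "size (exceptional Q) = 1" using sz 3 by linarith
      then obtain z where z: "exceptional Q = {#z#}" using size_1_singleton_mset by blast
      show ?thesis
        using degree_le_4_if_one_exceptional[of "full_count P" _ d "full_count Q" _ z] sumP sumQ True z
          exceptional_singleton[OF part(2) z] ge2 full by simp
    next
      case False
      then have 0: "size (exceptional Q) = 0" and "size (exceptional P) = 1" using sz 3 by linarith+
      then obtain z where z: "exceptional P = {#z#}" using size_1_singleton_mset by blast
      show ?thesis
        using degree_le_4_if_one_exceptional[of "full_count Q" _ d "full_count P" _ z] sumP sumQ 0 z
          exceptional_singleton[OF part(1) z] ge2 full by simp
    qed
    then show False
      using two_parts_without_multiple[of x y] pos ndvd[of x] ndvd[of y] sumR by (simp add: xy)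
  next
    case 4
    then obtain x y z where xyz: "R = {#x, y, z#}"
      by (rule size_3_sorted[where f = id])
    have "exceptional P = {#}" "exceptional Q = {#}" using sz 4 by simp_all
    then have d: "d \<le> 6 \<and> (d = 6 \<longrightarrow> partition_lcm P = 2 \<and> partition_lcm Q = 3 \<or>
        partition_lcm P = 3 \<and> partition_lcm Q = 2)"
      using degree_le_6_if_no_exceptional[of "full_count P" _ d "full_count Q"] sumP sumQ ge2 full by simp
    have "x + y + z = 6 \<and> {x, y, z} = {1, 2, 3}"
      using three_parts_without_multiple[of x y z] d pos ndvd[of x] ndvd[of y] ndvd[of z] sumR
      by (simp add: xyz)
    then have "d = 6" and "set_mset R = {1, 2, 3}" using sumR by (simp_all add: xyz)
    \<comment> \<open>The orders are then 2, 3 and at most 6, and 1/2 + 1/3 + 1/6 = 1 contradicts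
      hyperbolicity.\<close>
    then have "partition_lcm R dvd 6"
      unfolding partition_lcm_def by (intro Lcm_least) auto
    then have "partition_lcm R \<le> 6" by (rule dvd_imp_le) simp
    then show False using hyp d \<open>d = 6\<close> by auto
  qed
qed

lemma full_count_pos:
  assumes "cover_triple d P Q R"
  shows "full_count P \<ge> 1" "full_count Q \<ge> 1" "full_count R \<ge> 1"
proof -
  have "cover_triple d Q R P" "cover_triple d R P Q"
    using assms cover_triple_rotate by blast+
  then show "full_count P \<ge> 1" "full_count Q \<ge> 1" "full_count R \<ge> 1"
    using assms[THEN full_count_nonzero] full_count_nonzero by (simp_all add: Suc_le_eq)
qed

section \<open>Numerical solutions for each triple of base orders\<close>

lemma solutions_2_3_7:
  fixes d :: nat
  assumes d: "m1 * 2 + e1 = d" "m2 * 3 + e2 = d" "m3 * 7 + e3 = d"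
    and m: "m1 + m2 + m3 + 1 = d" "m3 \<ge> 1" and e: "e1 + e2 + e3 = 3"
  shows "(m1, m2, m3, e1, e2, e3, d) \<in>
    {(12, 8, 3, 0, 0, 3, 24), (8, 5, 2, 0, 1, 2, 16), (4, 3, 1, 1, 0, 2, 9), (4, 2, 1, 0, 2, 1, 8)}"
proof -
  \<comment> \<open>Weights 21, 14, 6 clear the denominators in the relation for \<open>d\<close>;
    as the orders are prime, each \<open>e\<close> is both the number and the sum of exceptional
    entries equal to 1. The analogous lemmas below scale by 24, 18 and 20.\<close>
  have eq: "d + 21 * e1 + 14 * e2 + 6 * e3 = 42" using d m(1) by linarith
  have "d \<ge> 7" using d(3) m(2) by linarith
  then have "e1 = 0 \<or> e1 = 1" "e2 = 0 \<or> e2 = 1 \<or> e2 = 2" "e3 = 3 - e1 - e2" using eq e by linarith+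
  then show ?thesis using eq \<open>d \<ge> 7\<close> d m by (elim disjE; simp)
qed

text \<open>\<open>a\<close>, \<open>b\<close>, \<open>c\<close> are the multiplicities of the
  proper divisors 1, 2, 4 of 8, and \<open>f\<close> is the sum of these exceptional
  entries.\<close>

lemma solutions_2_3_8:
  fixes d :: nat
  assumes d: "m1 * 2 + e1 = d" "m2 * 3 + e2 = d" "m3 * 8 + f = d"
    and m: "m1 + m2 + m3 + 1 = d" "m3 \<ge> 1"
    and e: "e1 + e2 + (a + b + c) = 3" and f: "f = a + 2 * b + 4 * c"
  shows "(m1, m2, m3, e1, e2, a, b, c, d) \<in> {(6, 4, 1, 0, 0, 2, 1, 0, 12), (5, 3, 1, 0, 1, 2, 0, 0, 10)}"
proof -
  have eq: "d + 12 * e1 + 8 * e2 + 3 * f = 24" using d m(1) by linarith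
  have "d \<ge> 8" using d(3) m(2) by linarith
  \<comment> \<open>Integrality of the counts rejects spurious solutions of \<open>eq\<close>, such
    as \<open>a = 3\<close> with \<open>d = 15\<close>.\<close>
  have mod: "d mod 2 = e1 mod 2" "d mod 8 = f mod 8"
    using mod_mult_self3[of m1 2 e1] mod_mult_self3[of m3 8 f] unfolding d by simp_all
  have "e1 = 0 \<or> e1 = 1" "e2 = 0 \<or> e2 = 1 \<or> e2 = 2" "c = 0 \<or> c = 1" "b = 0 \<or> b = 1 \<or> b = 2"
    "a = 3 - e1 - e2 - b - c" "d = 24 - 12 * e1 - 8 * e2 - 3 * f"
    using eq e f \<open>d \<ge> 8\<close> by linarith+
  then have "(e1, e2, a, b, c, d) \<in> {(0, 0, 2, 1, 0, 12), (0, 1, 2, 0, 0, 10)}"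
    using \<open>d \<ge> 8\<close> mod e unfolding f by (elim disjE; simp)
  then show ?thesis using d m f by auto
qed

lemma solutions_2_3_9:
  fixes d :: nat
  assumes d: "m1 * 2 + e1 = d" "m2 * 3 + e2 = d" "m3 * 9 + f = d"
    and m: "m1 + m2 + m3 + 1 = d" "m3 \<ge> 1"
    and e: "e1 + e2 + (a + b) = 3" and f: "f = a + 3 * b"
  shows "(m1, m2, m3, e1, e2, a, b, d) = (6, 4, 1, 0, 0, 3, 0, 12)"
proof -
  have eq: "d + 9 * e1 + 6 * e2 + 2 * f = 18" using d m(1) by linarith
  have "d \<ge> 9" using d(3) m(2) by linarith
  \<comment> \<open>At most 9 is left for \<open>9 * e1 + 6 * e2 + 2 * f\<close>. An entry 1 of the
    third partition costs 2 and any other exceptional entry at least 6, so one of the latter would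
    bring the total to at least 10.\<close>
  then have "e1 = 0" "e2 = 0" "b = 0" using eq e f by linarith+
  then show ?thesis using eq d m e f by simp
qed

lemma solutions_2_4_5:
  fixes d :: nat
  assumes d: "m1 * 2 + e1 = d" "m2 * 4 + f = d" "m3 * 5 + e3 = d"
    and m: "m1 + m2 + m3 + 1 = d" "m3 \<ge> 1"
    and e: "e1 + (a + b) + e3 = 3" and f: "f = a + 2 * b"
  shows "(m1, m2, m3, e1, a, b, e3, d) \<in> {(4, 2, 1, 0, 0, 0, 3, 8), (3, 1, 1, 0, 2, 0, 1, 6)}"
proof -
  have eq: "d + 10 * e1 + 5 * f + 4 * e3 = 20" using d m(1) by linarith
  have "d \<ge> 5" using d(3) m(2) by linarith
  \<comment> \<open>This rejects, for instance, \<open>a = 1\<close>, \<open>e3 = 2\<close> with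
    \<open>d = 7\<close>.\<close>
  have mod: "d mod 2 = e1 mod 2" "d mod 4 = f mod 4"
    using mod_mult_self3[of m1 2 e1] mod_mult_self3[of m2 4 f] unfolding d by simp_all
  have "e1 = 0 \<or> e1 = 1" "b = 0 \<or> b = 1" "a = 0 \<or> a = 1 \<or> a = 2 \<or> a = 3"
    "e3 = 3 - e1 - a - b" "d = 20 - 10 * e1 - 5 * f - 4 * e3"
    using eq e f \<open>d \<ge> 5\<close> by linarith+
  then have "(e1, a, b, e3, d) \<in> {(0, 0, 0, 3, 8), (0, 2, 0, 1, 6)}"
    using \<open>d \<ge> 5\<close> mod e unfolding f by (elim disjE; simp)
  then show ?thesis using d m f by auto
qed

section \<open>Exceptional parts for the orders that occur\<close>

lemma exceptional_eq_sum:
  assumes "is_partition d P" "finite A"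
    and "\<And>k. k dvd partition_lcm P \<Longrightarrow> k < partition_lcm P \<Longrightarrow> k \<in> A"
  shows "exceptional P = (\<Sum>k\<in>A. replicate_mset (count (exceptional P) k) k)"
  using exceptional_dvd[OF assms(1)] assms(2,3) by (intro mset_eq_sum_count) auto

lemma proper_divisor_prime:
  fixes k p :: nat
  assumes "k dvd p" "k < p" "p \<in> {2, 3, 5, 7}"
  shows "k \<in> {1}"
proof -
  have "k = 0 \<or> k = 1 \<or> k = 2 \<or> k = 3 \<or> k = 4 \<or> k = 5 \<or> k = 6"
    using assms(2,3) by auto
  then show ?thesis using assms by (elim disjE insertE emptyE; simp)
qed

lemma exceptional_prime:
  assumes "is_partition d P" "partition_lcm P \<in> {2, 3, 5, 7}"
  obtains e where "exceptional P = replicate_mset e 1"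
  using exceptional_eq_sum[OF assms(1), of "{1}"] proper_divisor_prime[OF _ _ assms(2)] by auto

lemma exceptional_4:
  assumes "is_partition d P" "partition_lcm P = 4"
  obtains a b where "exceptional P = replicate_mset a 1 + replicate_mset b 2"
proof -
  have "k \<in> {1, 2}" if "k dvd 4" "k < 4" for k :: nat
  proof -
    have "k = 0 \<or> k = 1 \<or> k = 2 \<or> k = 3" using that(2) by presburger
    then show ?thesis using that(1) by (elim disjE; simp)
  qed
  from exceptional_eq_sum[OF assms(1), of "{1, 2}", unfolded assms(2), OF _ this]
  show thesis using that by simp
qed

lemma exceptional_8:
  assumes "is_partition d P" "partition_lcm P = 8"
  obtains a b c where
    "exceptional P = replicate_mset a 1 + replicate_mset b 2 + replicate_mset c 4"
proof -
  have "k \<in> {1, 2, 4}" if "k dvd 8" "k < 8" for k :: nat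
  proof -
    have "k = 0 \<or> k = 1 \<or> k = 2 \<or> k = 3 \<or> k = 4 \<or> k = 5 \<or> k = 6 \<or> k = 7"
      using that(2) by presburger
    then show ?thesis using that(1) by (elim disjE; simp)
  qed
  from exceptional_eq_sum[OF assms(1), of "{1, 2, 4}", unfolded assms(2), OF _ this]
  show thesis using that by (simp add: add.assoc)
qed

lemma exceptional_9:
  assumes "is_partition d P" "partition_lcm P = 9"
  obtains a b where "exceptional P = replicate_mset a 1 + replicate_mset b 3"
proof -
  have "k \<in> {1, 3}" if "k dvd 9" "k < 9" for k :: nat
  proof -
    have "k = 0 \<or> k = 1 \<or> k = 2 \<or> k = 3 \<or> k = 4 \<or> k = 5 \<or> k = 6 \<or> k = 7 \<or> k = 8"
      using that(2) by presburger
    then show ?thesis using that(1) by (elim disjE; simp)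
  qed
  from exceptional_eq_sum[OF assms(1), of "{1, 3}", unfolded assms(2), OF _ this]
  show thesis using that by simp
qed

section \<open>The list of covers\<close>

lemma cover_triple_cases:
  assumes t: "cover_triple d P Q R"
    and le: "partition_lcm P \<le> partition_lcm Q" "partition_lcm Q \<le> partition_lcm R"
  shows "(d, {#P, Q, R#}) \<in>
   {(6, {#{#5, 1#}, {#4, 1, 1#}, replicate_mset 3 2#}),
    (8, {#{#5, 1, 1, 1#}, {#4, 4#}, replicate_mset 4 2#}),
    (8, {#{#7, 1#}, {#3, 3, 1, 1#}, replicate_mset 4 2#}),
    (9, {#{#7, 1, 1#}, {#3, 3, 3#}, replicate_mset 4 2 + {#1#}#}),
    (10, {#{#8, 1, 1#}, {#3, 3, 3, 1#}, replicate_mset 5 2#}),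
    (12, {#{#8, 2, 1, 1#}, replicate_mset 4 3, replicate_mset 6 2#}),
    (12, {#{#9, 1, 1, 1#}, replicate_mset 4 3, replicate_mset 6 2#}),
    (16, {#{#7, 7, 1, 1#}, replicate_mset 5 3 + {#1#}, replicate_mset 8 2#}),
    (24, {#{#7, 7, 7, 1, 1, 1#}, replicate_mset 8 3, replicate_mset 12 2#})}"
proof -
  have part: "is_partition d P" "is_partition d Q" "is_partition d R"
    and ge2: "partition_lcm P \<ge> 2"
    and sz: "size (exceptional P) + size (exceptional Q) + size (exceptional R) = 3"
    and full: "full_count P + full_count Q + full_count R + 1 = d"
    and hyp: "partition_lcm Q * partition_lcm R + partition_lcm P * partition_lcm R
       + partition_lcm P * partition_lcm Q
       < partition_lcm P * partition_lcm Q * partition_lcm R"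
    using t by (simp_all add: cover_triple_def)
  note pos = full_count_pos[OF t]
  note sum = part[THEN partition_sum]
  note decomp = partition_decomp[of P] partition_decomp[of Q] partition_decomp[of R]
  \<comment> \<open>There are three exceptional entries, each at least 1.\<close>
  have "sum_mset (exceptional P) + sum_mset (exceptional Q) + sum_mset (exceptional R) \<ge> 3"
    using part[THEN size_exceptional_le_sum] sz by linarith
  from orders_cases[OF pos full sum this ge2 le hyp]
  consider (237) "partition_lcm P = 2" "partition_lcm Q = 3" "partition_lcm R = 7"
    | (238) "partition_lcm P = 2" "partition_lcm Q = 3" "partition_lcm R = 8"
    | (239) "partition_lcm P = 2" "partition_lcm Q = 3" "partition_lcm R = 9"
    | (245) "partition_lcm P = 2" "partition_lcm Q = 4" "partition_lcm R = 5"
    by auto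
  then show ?thesis
  proof cases
    case 237
    obtain e1 where E1: "exceptional P = replicate_mset e1 1"
      by (rule exceptional_prime[OF part(1)]) (simp_all add: 237)
    obtain e2 where E2: "exceptional Q = replicate_mset e2 1"
      by (rule exceptional_prime[OF part(2)]) (simp_all add: 237)
    obtain e3 where E3: "exceptional R = replicate_mset e3 1"
      by (rule exceptional_prime[OF part(3)]) (simp_all add: 237)
    have "(full_count P, full_count Q, full_count R, e1, e2, e3, d) \<in>
      {(12, 8, 3, 0, 0, 3, 24), (8, 5, 2, 0, 1, 2, 16), (4, 3, 1, 1, 0, 2, 9), (4, 2, 1, 0, 2, 1, 8)}"
      using sum sz by (intro solutions_2_3_7[OF _ _ _ full pos(3)]) (simp_all add: 237 E1 E2 E3)
    then show ?thesis
      \<comment> \<open>\<open>decomp\<close> rebuilds the partitions from the counts. The list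
        names them by decreasing lcm, opposite to \<open>P\<close>, \<open>Q\<close>,
        \<open>R\<close>; \<open>add_mset_commute\<close> absorbs the difference.\<close>
      using decomp unfolding 237 E1 E2 E3 by (elim insertE emptyE; simp add: add_mset_commute numeral_eq_Suc)
  next
    case 238
    obtain e1 where E1: "exceptional P = replicate_mset e1 1"
      by (rule exceptional_prime[OF part(1)]) (simp_all add: 238)
    obtain e2 where E2: "exceptional Q = replicate_mset e2 1"
      by (rule exceptional_prime[OF part(2)]) (simp_all add: 238)
    obtain a b c where
      E3: "exceptional R = replicate_mset a 1 + replicate_mset b 2 + replicate_mset c 4"
      by (rule exceptional_8[OF part(3) 238(3)])
    have "(full_count P, full_count Q, full_count R, e1, e2, a, b, c, d) \<in>
      {(6, 4, 1, 0, 0, 2, 1, 0, 12), (5, 3, 1, 0, 1, 2, 0, 0, 10)}"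
      using sum sz
      by (intro solutions_2_3_8[OF _ _ _ full pos(3) _ refl]) (simp_all add: 238 E1 E2 E3 mult.commute)
    then show ?thesis
      using decomp unfolding 238 E1 E2 E3 by (elim insertE emptyE; simp add: add_mset_commute numeral_eq_Suc)
  next
    case 239
    obtain e1 where E1: "exceptional P = replicate_mset e1 1"
      by (rule exceptional_prime[OF part(1)]) (simp_all add: 239)
    obtain e2 where E2: "exceptional Q = replicate_mset e2 1"
      by (rule exceptional_prime[OF part(2)]) (simp_all add: 239)
    obtain a b where E3: "exceptional R = replicate_mset a 1 + replicate_mset b 3"
      by (rule exceptional_9[OF part(3) 239(3)])
    have "(full_count P, full_count Q, full_count R, e1, e2, a, b, d) = (6, 4, 1, 0, 0, 3, 0, 12)"
      using sum sz
      by (intro solutions_2_3_9[OF _ _ _ full pos(3) _ refl]) (simp_all add: 239 E1 E2 E3 mult.commute)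
    then show ?thesis
      using decomp unfolding 239 E1 E2 E3 by (simp add: add_mset_commute numeral_eq_Suc)
  next
    case 245
    obtain e1 where E1: "exceptional P = replicate_mset e1 1"
      by (rule exceptional_prime[OF part(1)]) (simp_all add: 245)
    obtain a b where E2: "exceptional Q = replicate_mset a 1 + replicate_mset b 2"
      by (rule exceptional_4[OF part(2) 245(2)])
    obtain e3 where E3: "exceptional R = replicate_mset e3 1"
      by (rule exceptional_prime[OF part(3)]) (simp_all add: 245)
    have "(full_count P, full_count Q, full_count R, e1, a, b, e3, d) \<in>
      {(4, 2, 1, 0, 0, 0, 3, 8), (3, 1, 1, 0, 2, 0, 1, 6)}"
      using sum sz
      by (intro solutions_2_4_5[OF _ _ _ full pos(3) _ refl]) (simp_all add: 245 E1 E2 E3 mult.commute)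
    then show ?thesis
      using decomp unfolding 245 E1 E2 E3 by (elim insertE emptyE; simp add: add_mset_commute numeral_eq_Suc)
  qed
qed

section \<open>The listed covers have the required properties\<close>

lemma triangularI:
  "\<lbrakk>p \<ge> 2; q \<ge> 2; r \<ge> 2\<rbrakk> \<Longrightarrow> triangular \<lparr>genus = 0, cone_orders = {#p, q, r#}\<rparr>"
  unfolding triangular_def by blast

lemma hyperbolic_triangleI:
  "1 / real p + 1 / real q + 1 / real r < 1
    \<Longrightarrow> hyperbolic \<lparr>genus = 0, cone_orders = {#p, q, r#}\<rparr>"
  by (simp add: hyperbolic_def orbifold_euler_char_def euler_char_def)

definition induces_hyperbolic_triangles :: "surface_cover_data \<Rightarrow> bool" where
  "induces_hyperbolic_triangles C \<longleftrightarrow> candidate_surface_cover C \<and>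
     triangular (induced_cover C) \<and> hyperbolic (induced_cover C) \<and>
     triangular (induced_base C) \<and> hyperbolic (induced_base C)"

text \<open>Reduces each example to arithmetic. The condition on sizes is Riemann-Hurwitz in genus
  0, and \<open>a\<close>, \<open>b\<close>, \<open>c\<close> are the cone orders upstairs.\<close>

lemma sphere_coverI:
  assumes orders: "partition_lcm P = p" "partition_lcm Q = q" "partition_lcm R = r"
    and part: "is_partition d P" "is_partition d Q" "is_partition d R"
    and ge2: "p \<ge> 2" "q \<ge> 2" "r \<ge> 2"
    and size: "size P + size Q + size R = d + 2" and d: "d \<ge> 2"
    and nontriv: "\<exists>k\<in>#P. k > 1" "\<exists>k\<in>#Q. k > 1" "\<exists>k\<in>#R. k > 1"
    and cone: "filter_mset (\<lambda>k. k \<noteq> 1)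
      (image_mset ((div) p) P + image_mset ((div) q) Q + image_mset ((div) r) R) = {#a, b, c#}"
    and abc: "a \<ge> 2" "b \<ge> 2" "c \<ge> 2"
    and hyp: "1 / real a + 1 / real b + 1 / real c < 1" "1 / real p + 1 / real q + 1 / real r < 1"
  shows "induces_hyperbolic_triangles (sphere_cover d {#P, Q, R#})"
proof -
  have "int (size P) + int (size Q) + int (size R) = int d + 2"
    using size by linarith
  then have "candidate_surface_cover (sphere_cover d {#P, Q, R#})"
    using part d nontriv
    by (simp add: candidate_surface_cover_def sphere_cover_def euler_char_def)
  moreover have "induced_base (sphere_cover d {#P, Q, R#}) = \<lparr>genus = 0, cone_orders = {#p, q, r#}\<rparr>"
    by (simp add: induced_base_def sphere_cover_def orders)
  moreover have "induced_cover (sphere_cover d {#P, Q, R#}) = \<lparr>genus = 0, cone_orders = {#a, b, c#}\<rparr>"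
    using cone by (simp add: induced_cover_def sphere_cover_def orders add.assoc)
  ultimately show ?thesis
    unfolding induces_hyperbolic_triangles_def
    using triangularI[OF ge2] triangularI[OF abc] hyp[THEN hyperbolic_triangleI] by simp
qed

lemma example_covers:
  "induces_hyperbolic_triangles (sphere_cover 6 {#{#5, 1#}, {#4, 1, 1#}, replicate_mset 3 2#})"
  "induces_hyperbolic_triangles (sphere_cover 8 {#{#5, 1, 1, 1#}, {#4, 4#}, replicate_mset 4 2#})"
  "induces_hyperbolic_triangles (sphere_cover 8 {#{#7, 1#}, {#3, 3, 1, 1#}, replicate_mset 4 2#})"
  "induces_hyperbolic_triangles (sphere_cover 9 {#{#7, 1, 1#}, {#3, 3, 3#}, replicate_mset 4 2 + {#1#}#})"
  "induces_hyperbolic_triangles (sphere_cover 10 {#{#8, 1, 1#}, {#3, 3, 3, 1#}, replicate_mset 5 2#})"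
  "induces_hyperbolic_triangles (sphere_cover 12 {#{#8, 2, 1, 1#}, replicate_mset 4 3, replicate_mset 6 2#})"
  "induces_hyperbolic_triangles (sphere_cover 12 {#{#9, 1, 1, 1#}, replicate_mset 4 3, replicate_mset 6 2#})"
  "induces_hyperbolic_triangles (sphere_cover 16 {#{#7, 7, 1, 1#}, replicate_mset 5 3 + {#1#}, replicate_mset 8 2#})"
  "induces_hyperbolic_triangles (sphere_cover 24 {#{#7, 7, 7, 1, 1, 1#}, replicate_mset 8 3, replicate_mset 12 2#})"
proof -
  show "induces_hyperbolic_triangles (sphere_cover 6 {#{#5, 1#}, {#4, 1, 1#}, replicate_mset 3 2#})"
    \<comment> \<open>In each example \<open>a\<close>, \<open>b\<close>, \<open>c\<close> are the
      lcms divided by the exceptional entries, here 5/1, 4/1, 4/1. Every lcm is itself an entry, so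
      \<open>partition_lcm_eqI\<close> applies.\<close>
    by (rule sphere_coverI[where p = 5 and q = 4 and r = 2 and a = 5 and b = 4 and c = 4];
        (rule partition_lcm_eqI)?; auto simp: is_partition_def split: if_splits)
  show "induces_hyperbolic_triangles (sphere_cover 8 {#{#5, 1, 1, 1#}, {#4, 4#}, replicate_mset 4 2#})"
    by (rule sphere_coverI[where p = 5 and q = 4 and r = 2 and a = 5 and b = 5 and c = 5];
        (rule partition_lcm_eqI)?; auto simp: is_partition_def split: if_splits)
  show "induces_hyperbolic_triangles (sphere_cover 8 {#{#7, 1#}, {#3, 3, 1, 1#}, replicate_mset 4 2#})"
    by (rule sphere_coverI[where p = 7 and q = 3 and r = 2 and a = 7 and b = 3 and c = 3];
        (rule partition_lcm_eqI)?; auto simp: is_partition_def split: if_splits)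
  show "induces_hyperbolic_triangles (sphere_cover 9 {#{#7, 1, 1#}, {#3, 3, 3#}, replicate_mset 4 2 + {#1#}#})"
    by (rule sphere_coverI[where p = 7 and q = 3 and r = 2 and a = 7 and b = 7 and c = 2];
        (rule partition_lcm_eqI)?; auto simp: is_partition_def split: if_splits)
  show "induces_hyperbolic_triangles (sphere_cover 10 {#{#8, 1, 1#}, {#3, 3, 3, 1#}, replicate_mset 5 2#})"
    by (rule sphere_coverI[where p = 8 and q = 3 and r = 2 and a = 8 and b = 8 and c = 3];
        (rule partition_lcm_eqI)?; auto simp: is_partition_def split: if_splits)
  show "induces_hyperbolic_triangles (sphere_cover 12 {#{#8, 2, 1, 1#}, replicate_mset 4 3, replicate_mset 6 2#})"
    by (rule sphere_coverI[where p = 8 and q = 3 and r = 2 and a = 4 and b = 8 and c = 8];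
        (rule partition_lcm_eqI)?; auto simp: is_partition_def split: if_splits)
  show "induces_hyperbolic_triangles (sphere_cover 12 {#{#9, 1, 1, 1#}, replicate_mset 4 3, replicate_mset 6 2#})"
    by (rule sphere_coverI[where p = 9 and q = 3 and r = 2 and a = 9 and b = 9 and c = 9];
        (rule partition_lcm_eqI)?; auto simp: is_partition_def split: if_splits)
  show "induces_hyperbolic_triangles (sphere_cover 16 {#{#7, 7, 1, 1#}, replicate_mset 5 3 + {#1#}, replicate_mset 8 2#})"
    by (rule sphere_coverI[where p = 7 and q = 3 and r = 2 and a = 7 and b = 7 and c = 3];
        (rule partition_lcm_eqI)?; auto simp: is_partition_def split: if_splits)
  show "induces_hyperbolic_triangles (sphere_cover 24 {#{#7, 7, 7, 1, 1, 1#}, replicate_mset 8 3, replicate_mset 12 2#})"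
    by (rule sphere_coverI[where p = 7 and q = 3 and r = 2 and a = 7 and b = 7 and c = 7];
        (rule partition_lcm_eqI)?; auto simp: is_partition_def split: if_splits)
qed

theorem theorem4p1:
  "{C. candidate_surface_cover C \<and>
       triangular (induced_cover C) \<and> hyperbolic (induced_cover C) \<and>
       triangular (induced_base C) \<and> hyperbolic (induced_base C)} =
   {sphere_cover 6 {#{#5, 1#}, {#4, 1, 1#}, replicate_mset 3 2#},
    sphere_cover 8 {#{#5, 1, 1, 1#}, {#4, 4#}, replicate_mset 4 2#},
    sphere_cover 8 {#{#7, 1#}, {#3, 3, 1, 1#}, replicate_mset 4 2#},
    sphere_cover 9 {#{#7, 1, 1#}, {#3, 3, 3#}, replicate_mset 4 2 + {#1#}#},
    sphere_cover 10 {#{#8, 1, 1#}, {#3, 3, 3, 1#}, replicate_mset 5 2#},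
    sphere_cover 12 {#{#8, 2, 1, 1#}, replicate_mset 4 3, replicate_mset 6 2#},
    sphere_cover 12 {#{#9, 1, 1, 1#}, replicate_mset 4 3, replicate_mset 6 2#},
    sphere_cover 16 {#{#7, 7, 1, 1#}, replicate_mset 5 3 + {#1#}, replicate_mset 8 2#},
    sphere_cover 24 {#{#7, 7, 7, 1, 1, 1#}, replicate_mset 8 3, replicate_mset 12 2#}}"
proof (intro subset_antisym subsetI, unfold mem_Collect_eq, elim conjE)
  fix C
  assume "candidate_surface_cover C" "triangular (induced_cover C)"
    "triangular (induced_base C)" "hyperbolic (induced_base C)"
  then obtain P Q R where C: "C = sphere_cover (degree C) {#P, Q, R#}"
    and t: "cover_triple (degree C) P Q R"
      "partition_lcm P \<le> partition_lcm Q" "partition_lcm Q \<le> partition_lcm R"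
    by (rule cover_triple_obtain)
  \<comment> \<open>The classification speaks of pairs of degree and partitions; its image under
    \<open>sphere_cover\<close> is the list of covers.\<close>
  have "case_prod sphere_cover (degree C, {#P, Q, R#}) \<in> case_prod sphere_cover `
   {(6, {#{#5, 1#}, {#4, 1, 1#}, replicate_mset 3 2#}),
    (8, {#{#5, 1, 1, 1#}, {#4, 4#}, replicate_mset 4 2#}),
    (8, {#{#7, 1#}, {#3, 3, 1, 1#}, replicate_mset 4 2#}),
    (9, {#{#7, 1, 1#}, {#3, 3, 3#}, replicate_mset 4 2 + {#1#}#}),
    (10, {#{#8, 1, 1#}, {#3, 3, 3, 1#}, replicate_mset 5 2#}),
    (12, {#{#8, 2, 1, 1#}, replicate_mset 4 3, replicate_mset 6 2#}),
    (12, {#{#9, 1, 1, 1#}, replicate_mset 4 3, replicate_mset 6 2#}),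
    (16, {#{#7, 7, 1, 1#}, replicate_mset 5 3 + {#1#}, replicate_mset 8 2#}),
    (24, {#{#7, 7, 7, 1, 1, 1#}, replicate_mset 8 3, replicate_mset 12 2#})}"
    by (rule imageI) (rule cover_triple_cases[OF t])
  then show "C \<in>
   {sphere_cover 6 {#{#5, 1#}, {#4, 1, 1#}, replicate_mset 3 2#},
    sphere_cover 8 {#{#5, 1, 1, 1#}, {#4, 4#}, replicate_mset 4 2#},
    sphere_cover 8 {#{#7, 1#}, {#3, 3, 1, 1#}, replicate_mset 4 2#},
    sphere_cover 9 {#{#7, 1, 1#}, {#3, 3, 3#}, replicate_mset 4 2 + {#1#}#},
    sphere_cover 10 {#{#8, 1, 1#}, {#3, 3, 3, 1#}, replicate_mset 5 2#},
    sphere_cover 12 {#{#8, 2, 1, 1#}, replicate_mset 4 3, replicate_mset 6 2#},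
    sphere_cover 12 {#{#9, 1, 1, 1#}, replicate_mset 4 3, replicate_mset 6 2#},
    sphere_cover 16 {#{#7, 7, 1, 1#}, replicate_mset 5 3 + {#1#}, replicate_mset 8 2#},
    sphere_cover 24 {#{#7, 7, 7, 1, 1, 1#}, replicate_mset 8 3, replicate_mset 12 2#}}"
    unfolding image_insert image_empty prod.case C[symmetric] .
next
  fix C
  assume "C \<in>
   {sphere_cover 6 {#{#5, 1#}, {#4, 1, 1#}, replicate_mset 3 2#},
    sphere_cover 8 {#{#5, 1, 1, 1#}, {#4, 4#}, replicate_mset 4 2#},
    sphere_cover 8 {#{#7, 1#}, {#3, 3, 1, 1#}, replicate_mset 4 2#},
    sphere_cover 9 {#{#7, 1, 1#}, {#3, 3, 3#}, replicate_mset 4 2 + {#1#}#},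
    sphere_cover 10 {#{#8, 1, 1#}, {#3, 3, 3, 1#}, replicate_mset 5 2#},
    sphere_cover 12 {#{#8, 2, 1, 1#}, replicate_mset 4 3, replicate_mset 6 2#},
    sphere_cover 12 {#{#9, 1, 1, 1#}, replicate_mset 4 3, replicate_mset 6 2#},
    sphere_cover 16 {#{#7, 7, 1, 1#}, replicate_mset 5 3 + {#1#}, replicate_mset 8 2#},
    sphere_cover 24 {#{#7, 7, 7, 1, 1, 1#}, replicate_mset 8 3, replicate_mset 12 2#}}"
  then have "induces_hyperbolic_triangles C"
    using example_covers by (elim insertE emptyE) simp_all
  then show "candidate_surface_cover C \<and>
       triangular (induced_cover C) \<and> hyperbolic (induced_cover C) \<and>
       triangular (induced_base C) \<and> hyperbolic (induced_base C)"
    by (simp add: induces_hyperbolic_triangles_def)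
qed

end
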